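(* For $0<p<1$, $1\le s<r<1/p$, $a_n\ge 0$, we have $$\sum_{n=1}^{\infty}\left(\frac{1}{\sum_{i=1}^{n}i^{r-1}}\sum_{k=n}^{\infty}k^{r-1}a_k\right)^p<\frac{r^p(1-sp)}{s^p(1-rp)}\sum_{n=1}^{\infty}\left(\frac{1}{\sum_{i=1}^{n}i^{s-1}}\sum_{k=n}^{\infty}k^{s-1}a_k\right)^p .$$ The constant is best possible.
   Context: Here $p,r,s$ are real numbers and $(a_n)_{n\ge1}$ is any sequence of non-negative real numbers. The constant referred to is $\frac{r^p(1-sp)}{s^p(1-rp)}$. *)

theory Defs
  imports "HOL-Analysis.Analysis"
begin

text \<open>Sequences are indexed by the positive integers; the value at 0 of a function
  \<open>nat \<Rightarrow> real\<close> is never used.\<close>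

definition tail_mean :: "real \<Rightarrow> (nat \<Rightarrow> real) \<Rightarrow> nat \<Rightarrow> real" where
  "tail_mean r a n =
     1 / (\<Sum>i=1..n. real i powr (r - 1)) * (\<Sum>\<^sub>\<infinity>k\<in>{n..}. real k powr (r - 1) * a k)"

definition tail_mean_sum :: "real \<Rightarrow> real \<Rightarrow> (nat \<Rightarrow> real) \<Rightarrow> real" where
  "tail_mean_sum p r a = (\<Sum>\<^sub>\<infinity>n\<in>{1..}. tail_mean r a n powr p)"

text \<open>Real-valued infinite sums default to 0 when they diverge. For a non-negative sequence the
  following says that the double series, read in \<open>[0, \<infinity>]\<close>, has a finite value, namely
  \<open>tail_mean_sum p r a\<close>.\<close>

definition tail_mean_finite :: "real \<Rightarrow> real \<Rightarrow> (nat \<Rightarrow> real) \<Rightarrow> bool" where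
  "tail_mean_finite p r a \<longleftrightarrow>
     (\<forall>n\<ge>1. (\<lambda>k. real k powr (r - 1) * a k) summable_on {n..}) \<and>
     (\<lambda>n. tail_mean r a n powr p) summable_on {1..}"

definition copson_const :: "real \<Rightarrow> real \<Rightarrow> real \<Rightarrow> real" where
  "copson_const p r s = (r powr p * (1 - s * p)) / (s powr p * (1 - r * p))"

text \<open>The strict inequality is false for the zero sequence (\<open>0 < 0\<close>) and when the
  right-hand side is infinite, so the sequences it is about are the following.\<close>

definition admissible :: "real \<Rightarrow> real \<Rightarrow> (nat \<Rightarrow> real) \<Rightarrow> bool" where
  "admissible p s a \<longleftrightarrow>
     (\<forall>n\<ge>1. a n \<ge> 0) \<and> (\<exists>n\<ge>1. a n \<noteq> 0) \<and> tail_mean_finite p s a"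

end

theory Submission
  imports Defs
begin

text \<open>Let \<open>P t n\<close> be the sum of \<open>i powr (t - 1)\<close> over \<open>1 \<le> i \<le> n\<close>, let \<open>T\<close> and \<open>H\<close> be the tails of
  the series of \<open>k powr (s - 1) * a k\<close> and \<open>k powr (r - 1) * a k\<close>, and let \<open>W t n\<close> be the sum of
  \<open>P t k powr (- p)\<close> over \<open>1 \<le> k \<le> n\<close>. Summation by parts turns both sides into sums of \<open>W t n\<close>
  against increments of the \<open>p\<close>-th powers of the tails, and concavity of \<open>x powr p\<close> bounds the
  \<open>n\<close>-th increment for \<open>H\<close> by \<open>n powr ((r - s) * p)\<close> times that for \<open>T\<close>. It remains to see that
  \<open>n powr ((r - s) * p) * W r n < C * W s n\<close>, where \<open>C\<close> is the constant of the theorem.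
  This rests on the right Riemann sum \<open>R t n = t * P t n / n powr t\<close> of the integral of
  \<open>t * x powr (t - 1)\<close> over \<open>[0, 1]\<close>: it increases in \<open>t > 0\<close>, which is used both for the exponents
  \<open>s < r\<close> and for \<open>1 - r * p < 1 - s * p\<close>, and it decreases in \<open>n\<close> when \<open>t \<ge> 1\<close>. Sequences with a
  single nonzero entry, at \<open>N \<rightarrow> \<infinity>\<close>, show that \<open>C\<close> is best possible.\<close>

section \<open>Riemann sums of powers\<close>

definition power_sum :: "real \<Rightarrow> nat \<Rightarrow> real" where
  "power_sum t n = (\<Sum>i=1..n. real i powr (t - 1))"

definition riemann_sum :: "real \<Rightarrow> nat \<Rightarrow> real" where
  "riemann_sum t n = t * power_sum t n / real n powr t"

lemma power_sum_0 [simp]: "power_sum t 0 = 0"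
  by (simp add: power_sum_def)

lemma power_sum_Suc: "power_sum t (Suc n) = power_sum t n + real (Suc n) powr (t - 1)"
  by (simp add: power_sum_def)

lemma power_sum_nonneg: "power_sum t n \<ge> 0"
  by (simp add: power_sum_def sum_nonneg)

lemma power_sum_pos: "n \<ge> 1 \<Longrightarrow> power_sum t n > 0"
  unfolding power_sum_def by (rule sum_pos) auto

lemma riemann_sum_pos: "n \<ge> 1 \<Longrightarrow> t > 0 \<Longrightarrow> riemann_sum t n > 0"
  using power_sum_pos[of n t] by (simp add: riemann_sum_def)

lemma power_sum_eq_riemann_sum:
  assumes "n \<ge> 1" "t > 0"
  shows "power_sum t n = riemann_sum t n * real n powr t / t"
  using assms by (simp add: riemann_sum_def)

text \<open>The gap has derivative \<open>(1 - 1 / x)\<^sup>2\<close>. For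
  \<open>y = sqrt (v / u)\<close> this compares the geometric with the logarithmic mean of
  \<open>u\<close> and \<open>v\<close>.\<close>

lemma two_ln_le_diff_inverse:
  fixes y :: real
  assumes "y \<ge> 1"
  shows "2 * ln y \<le> y - 1 / y"
proof -
  let ?f = "\<lambda>y::real. y - 1 / y - 2 * ln y"
  have "?f 1 \<le> ?f y"
  proof (rule DERIV_nonneg_imp_nondecreasing[OF assms])
    fix x :: real assume x: "1 \<le> x" "x \<le> y"
    have "(?f has_real_derivative ((1 - 1 / x)\<^sup>2)) (at x)"
      using x by (auto intro!: derivative_eq_intros simp: power2_eq_square field_simps)
    then show "\<exists>D. (?f has_real_derivative D) (at x) \<and> 0 \<le> D" by auto
  qed
  then show ?thesis by simp
qed

text \<open>\<open>1 / ln ((x + 1) / x)\<close> is the logarithmic mean of \<open>x\<close> and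
  \<open>x + 1\<close>. Its derivative is its square over \<open>x * (x + 1)\<close>, hence at least
  1 by the comparison with the geometric mean.\<close>

lemma inverse_ln_succ:
  fixes x :: real
  assumes "x > 0"
  shows "1 / ln ((x + 1) / x) + 1 \<le> 1 / ln ((x + 2) / (x + 1))"
proof -
  let ?f = "\<lambda>x::real. 1 / (ln (x + 1) - ln x) - x"
  have "?f x \<le> ?f (x + 1)"
  proof (rule DERIV_nonneg_imp_nondecreasing[where f = ?f])
    fix z :: real assume "x \<le> z" "z \<le> x + 1"
    with assms have z: "z > 0" by simp
    define l where "l = ln (z + 1) - ln z"
    \<comment> \<open>Chosen so that \<open>2 * ln y = l\<close>, while \<open>y - 1 / y\<close> is
      the inverse of the geometric mean of \<open>z\<close> and \<open>z + 1\<close>.\<close>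
    define y where "y = sqrt ((z + 1) / z)"
    have l_pos: "l > 0" using z by (simp add: l_def)
    have y: "y \<ge> 1" "y\<^sup>2 = (z + 1) / z" using z by (auto simp: y_def)
    have "l = ln (y\<^sup>2)" using z by (simp add: y l_def ln_div)
    also have "\<dots> = 2 * ln y" using ln_realpow[of y 2] y(1) by simp
    finally have "l \<le> y - 1 / y" using two_ln_le_diff_inverse[OF y(1)] by simp
    then have "l\<^sup>2 \<le> (y - 1 / y)\<^sup>2" using l_pos by (intro power_mono) auto
    also have "\<dots> = y\<^sup>2 + 1 / y\<^sup>2 - 2" using y(1) by (simp add: power2_eq_square field_simps)
    also have "\<dots> = 1 / (z * (z + 1))"
      unfolding y(2) using z add_pos_pos[of z "z * z"] by (simp add: field_simps)
    finally have "l\<^sup>2 * (z * (z + 1)) \<le> 1"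
      using z by (simp add: pos_le_divide_eq)
    moreover have "l\<^sup>2 * (z * (z + 1)) > 0" using z l_pos by simp
    ultimately have "1 / (l\<^sup>2 * (z * (z + 1))) - 1 \<ge> 0"
      by (simp add: pos_le_divide_eq)
    moreover have "(?f has_real_derivative (1 / (l\<^sup>2 * (z * (z + 1))) - 1)) (at z)"
    proof -
      have "((\<lambda>x. ln (x + 1) - ln x) has_real_derivative (1 / (z + 1) - 1 / z)) (at z)"
        using z by (auto intro!: derivative_eq_intros)
      moreover have "1 / (z + 1) - 1 / z = - 1 / (z * (z + 1))"
        using z by (simp add: divide_simps)
      ultimately have d: "((\<lambda>x. ln (x + 1) - ln x) has_real_derivative (- 1 / (z * (z + 1)))) (at z)"
        by simp
      have "ln (z + 1) - ln z \<noteq> 0" using l_pos by (simp add: l_def)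
      from DERIV_diff[OF DERIV_divide[OF DERIV_const[of 1] d this] DERIV_ident]
      have "(?f has_real_derivative ((0 * l - 1 * (- 1 / (z * (z + 1)))) / (l * l) - 1)) (at z)"
        by (simp add: l_def)
      then show ?thesis by (simp add: power2_eq_square mult.commute)
    qed
    ultimately show "\<exists>D. (?f has_real_derivative D) (at z) \<and> 0 \<le> D" by blast
  qed simp
  then show ?thesis using assms by (simp add: ln_div add.commute)
qed

text \<open>Divided by \<open>(real n + 1) powr t\<close>, this says that the recursion
  \<open>riemann_sum_Suc\<close>, with \<open>riemann_sum t n\<close> held fixed, has nonnegative
  derivative in \<open>t\<close>: the gain in \<open>t / (n + 1)\<close> covers the loss in
  \<open>(n / (n + 1)) powr t\<close>.\<close>

lemma power_sum_ln_le:
  assumes "n \<ge> 1" "t > 0"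
  shows "t * power_sum t n * ln ((real n + 1) / real n) \<le> (real n + 1) powr (t - 1)"
  using assms(1)
proof (induction n rule: nat_induct_at_least)
  case base
  have "1 + (t - 1) * ln 2 \<le> exp ((t - 1) * ln 2)" by (rule exp_ge_add_one_self)
  moreover have "ln 2 \<le> (1::real)" using ln_le_minus_one[of "2::real"] by simp
  ultimately show ?case by (simp add: power_sum_def powr_def algebra_simps)
next
  case (Suc n)
  define l where "l = ln ((real n + 1) / real n)"
  define l' where "l' = ln ((real n + 2) / (real n + 1))"
  define u where "u = (real n + 1) powr (t - 1)"
  define S where "S = power_sum t n"
  have pos: "l > 0" "l' > 0" "u > 0" using Suc.hyps by (auto simp: l_def l'_def u_def)
  have IH: "t * S * l \<le> u" using Suc.IH by (simp add: S_def l_def u_def)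
  have "1 / l + 1 \<le> 1 / l'" using inverse_ln_succ[of "real n"] Suc.hyps by (simp add: l_def l'_def)
  \<comment> \<open>Hence \<open>l' / l + t * l'\<close> is at most \<open>1 + (t - 1) * l'\<close>,
    a tangent of the exponential, and \<open>exp ((t - 1) * l')\<close> is the ratio of consecutive
    right-hand sides.\<close>
  then have step: "l' / l + l' \<le> 1" using pos by (simp add: field_simps)
  have "t * S \<le> u / l" using IH pos by (simp add: field_simps)
  then have "t * S * l' \<le> u / l * l'" using pos by (intro mult_right_mono) auto
  then have "t * (S + u) * l' \<le> u * (l' / l + t * l')" by (simp add: algebra_simps)
  also have "\<dots> \<le> u * (1 + (t - 1) * l')" using step pos by (intro mult_left_mono) (auto simp: algebra_simps)
  also have "\<dots> \<le> u * exp ((t - 1) * l')" using pos by (intro mult_left_mono exp_ge_add_one_self) auto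
  also have "\<dots> = (real n + 2) powr (t - 1)"
    by (simp add: u_def l'_def powr_def ln_div exp_add[symmetric] algebra_simps)
  finally show ?case
    by (simp add: S_def u_def l'_def power_sum_Suc add.commute)
qed

lemma riemann_sum_Suc:
  assumes "n \<ge> 1"
  shows "riemann_sum t (Suc n) =
    riemann_sum t n * (real n / (real n + 1)) powr t + t / (real n + 1)"
  using assms
  by (simp add: riemann_sum_def power_sum_Suc powr_divide powr_diff add.commute field_simps)

text \<open>Induction along \<open>riemann_sum_Suc\<close>. Strictness comes from
  \<open>n = 1\<close>, where the values are \<open>s\<close> and \<open>r\<close>, and survives
  multiplication by \<open>x powr r > 0\<close>.\<close>

lemma riemann_sum_strict_mono:
  assumes "n \<ge> 1" "0 < s" "s < r"
  shows "riemann_sum s n < riemann_sum r n"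
  using assms(1)
proof (induction n rule: nat_induct_at_least)
  case base
  then show ?case using assms by (simp add: riemann_sum_def power_sum_def)
next
  case (Suc n)
  define l where "l = ln ((real n + 1) / real n)"
  define x where "x = real n / (real n + 1)"
  have l_pos: "l > 0" and x_pos: "x > 0" using Suc.hyps by (auto simp: l_def x_def)
  have ln_x: "ln x = - l" using Suc.hyps by (simp add: x_def l_def ln_div)
  have "riemann_sum s n * x powr s * l = s * power_sum s n * l / (real n + 1) powr s"
    using Suc.hyps by (simp add: riemann_sum_def x_def powr_divide)
  also have "\<dots> \<le> (real n + 1) powr (s - 1) / (real n + 1) powr s"
    using power_sum_ln_le[OF Suc.hyps \<open>0 < s\<close>] by (intro divide_right_mono) (auto simp: l_def)
  also have "\<dots> = 1 / (real n + 1)" by (simp add: powr_diff)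
  finally have bound: "riemann_sum s n * x powr s * l \<le> 1 / (real n + 1)" .
  \<comment> \<open>Convexity of the exponential: between \<open>s\<close> and \<open>r\<close> the
    power of \<open>x\<close> falls by at most its tangent at \<open>s\<close>, whose slope is what
    \<open>bound\<close> controls.\<close>
  have "x powr r = x powr s * exp (- ((r - s) * l))"
    using x_pos by (simp add: powr_def ln_x exp_add[symmetric] algebra_simps)
  moreover have "1 - (r - s) * l \<le> exp (- ((r - s) * l))"
    using exp_ge_add_one_self[of "- ((r - s) * l)"] by linarith
  ultimately have "x powr s - x powr r \<le> x powr s * ((r - s) * l)"
    using mult_left_mono[of "1 - (r - s) * l" "exp (- ((r - s) * l))" "x powr s"]
    by (simp add: algebra_simps)
  then have "riemann_sum s n * (x powr s - x powr r) \<le> riemann_sum s n * (x powr s * ((r - s) * l))"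
    using riemann_sum_pos[OF Suc.hyps \<open>0 < s\<close>] by (intro mult_left_mono) auto
  also have "\<dots> \<le> (r - s) * (1 / (real n + 1))"
    using mult_left_mono[OF bound, of "r - s"] assms by (simp add: algebra_simps)
  finally have "riemann_sum s n * x powr s + s / (real n + 1)
      \<le> riemann_sum s n * x powr r + r / (real n + 1)"
    by (simp add: algebra_simps diff_divide_distrib)
  also have "\<dots> < riemann_sum r n * x powr r + r / (real n + 1)"
    using Suc.IH x_pos by simp
  finally show ?case using Suc.hyps by (simp add: riemann_sum_Suc x_def)
qed

text \<open>For \<open>n \<ge> 1\<close> this is one step of the decrease of
  \<open>riemann_sum s\<close> in \<open>n\<close>, cleared of denominators so that the induction
  can start at 0.\<close>

lemma power_sum_ge:
  assumes "s \<ge> 1"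
  shows "(real n + 1) powr (s - 1) * real n powr s
    \<le> power_sum s n * ((real n + 1) powr s - real n powr s)"
proof (induction n)
  case 0
  then show ?case using assms by simp
next
  case (Suc n)
  define a b c where "a = real n" and "b = real n + 1" and "c = real n + 2"
  have abc: "a \<ge> 0" "b > 0" "c > 0" "a < b" "b < c" by (auto simp: a_def b_def c_def)
  \<comment> \<open>Convexity of \<open>x powr s\<close> at \<open>b / c\<close>, the mean of
    \<open>a / b\<close> and \<open>1\<close> with weights \<open>b / c\<close> and
    \<open>1 / c\<close>, multiplied by \<open>b powr s * c powr s\<close>. For \<open>a = 0\<close>
    it reads \<open>1 \<le> 2 powr s / 2\<close>.\<close>
  have conv: "b powr s * b powr s \<le> a powr s * c powr s * (b / c) + b powr s * (c powr s) * (1 / c)"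
  proof (cases "n = 0")
    case True
    then show ?thesis using assms powr_mono[of 1 s 2] by (simp add: a_def b_def c_def)
  next
    case False
    then have a: "a > 0" by (simp add: a_def)
    have "(b / c * (a / b) + 1 / c * 1) powr s \<le> b / c * (a / b) powr s + 1 / c * 1 powr s"
      using convex_onD[OF powr_convex[OF assms], of "1 / c" "a / b" 1] a abc
      by (simp add: a_def b_def c_def field_simps)
    moreover have "b / c * (a / b) = a / c" using abc by simp
    moreover have "a / c + 1 / c = b / c" by (simp add: a_def b_def add_divide_distrib)
    ultimately have "(b / c) powr s \<le> b / c * (a / b) powr s + 1 / c" by simp
    then have "(b powr s * c powr s) * (b / c) powr s
        \<le> (b powr s * c powr s) * (b / c * (a / b) powr s + 1 / c)"
      by (rule mult_left_mono) simp
    moreover have "(b powr s * c powr s) * (b / c) powr s = b powr s * b powr s"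
      using abc by (simp add: powr_divide)
    moreover have "(b powr s * c powr s) * (b / c * (a / b) powr s + 1 / c)
        = a powr s * c powr s * (b / c) + b powr s * (c powr s) * (1 / c)"
      using a abc by (simp add: powr_divide distrib_left)
    ultimately show ?thesis by simp
  qed
  define S where "S = power_sum s n"
  define d where "d = b powr s - a powr s"
  have d: "d > 0" using abc assms by (simp add: d_def powr_less_mono2)
  have IH: "b powr (s - 1) * a powr s \<le> S * d"
    using Suc.IH by (simp add: a_def b_def S_def d_def)
  have e: "c powr s - b powr s > 0" using abc assms by (simp add: powr_less_mono2)
  \<comment> \<open>The induction hypothesis bounds \<open>S * d\<close>, so the goal is proved with
    an extra factor \<open>d > 0\<close>, cancelled at the end.\<close>
  have "d * (c powr (s - 1) * b powr s) \<le> (b powr (s - 1) * b powr s) * (c powr s - b powr s)"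
  proof -
    have "c * (b powr s * b powr s)
        \<le> b * (a powr s * c powr s) + b powr s * c powr s"
      using conv abc by (simp add: field_simps)
    moreover have "c = b + 1" by (simp add: b_def c_def)
    ultimately have "b * (d * c powr s) \<le> c * (b powr s * (c powr s - b powr s))"
      by (simp add: d_def algebra_simps)
    then have "b powr s / (b * c) * (b * (d * c powr s))
        \<le> b powr s / (b * c) * (c * (b powr s * (c powr s - b powr s)))"
      using abc by (intro mult_left_mono) auto
    then show ?thesis using abc by (simp add: powr_diff mult.commute mult.left_commute)
  qed
  also have "b powr (s - 1) * b powr s = b powr (s - 1) * a powr s + b powr (s - 1) * d"
    by (simp add: d_def algebra_simps)
  also have "\<dots> * (c powr s - b powr s) \<le> (S * d + b powr (s - 1) * d) * (c powr s - b powr s)"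
    using IH e by (intro mult_right_mono) auto
  also have "\<dots> = d * ((S + b powr (s - 1)) * (c powr s - b powr s))" by (simp add: algebra_simps)
  finally have "c powr (s - 1) * b powr s \<le> (S + b powr (s - 1)) * (c powr s - b powr s)"
    using d by simp
  then show ?case by (simp add: S_def b_def c_def power_sum_Suc add.commute)
qed

lemma riemann_sum_decreasing:
  assumes "s \<ge> 1" "1 \<le> m" "m \<le> n"
  shows "riemann_sum s n \<le> riemann_sum s m"
proof -
  have decr: "riemann_sum s (Suc n) \<le> riemann_sum s n" if n: "n \<ge> 1" for n
  proof -
    have "(power_sum s n + (real n + 1) powr (s - 1)) * real n powr s
        \<le> power_sum s n * (real n + 1) powr s"
      using power_sum_ge[OF assms(1), of n] by (simp add: algebra_simps)
    then have "power_sum s (Suc n) / real (Suc n) powr s \<le> power_sum s n / real n powr s"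
      using n by (simp add: power_sum_Suc field_simps)
    then show ?thesis using mult_left_mono[of _ _ s] assms(1) by (fastforce simp: riemann_sum_def)
  qed
  show ?thesis using assms(3,2)
  proof (induction n rule: dec_induct)
    case (step k)
    then show ?case using decr[of k] by linarith
  qed simp
qed

section \<open>Comparison of the Abel weights\<close>

definition inverse_sum :: "real \<Rightarrow> real \<Rightarrow> nat \<Rightarrow> real" where
  "inverse_sum p t n = (\<Sum>k=1..n. power_sum t k powr (- p))"

lemma inverse_sum_pos:
  assumes "n \<ge> 1"
  shows "inverse_sum p t n > 0"
  unfolding inverse_sum_def using assms power_sum_pos by (intro sum_pos) (auto simp: less_imp_neq [symmetric])

text \<open>A Chebyshev-type argument: let \<open>m\<close> be the first index with
  \<open>g m \<ge> 0\<close>. Replacing every weight by \<open>w m\<close> can only lower the sum,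
  because \<open>g\<close> is negative where the weights are smaller and nonnegative where they are
  larger.\<close>

lemma sum_mult_pos_of_single_crossing:
  fixes w g :: "nat \<Rightarrow> real"
  assumes "n \<ge> 1"
    and w_pos: "\<And>k. 1 \<le> k \<Longrightarrow> k \<le> n \<Longrightarrow> w k > 0"
    and w_mono: "\<And>i j. 1 \<le> i \<Longrightarrow> i \<le> j \<Longrightarrow> j \<le> n \<Longrightarrow> w i \<le> w j"
    and crossing: "\<And>i j. 1 \<le> i \<Longrightarrow> i \<le> j \<Longrightarrow> j \<le> n \<Longrightarrow> g i \<ge> 0 \<Longrightarrow> g j \<ge> 0"
    and "g n \<ge> 0" and sum_pos: "(\<Sum>k=1..n. g k) > 0"
  shows "(\<Sum>k=1..n. w k * g k) > 0"
proof -
  define m where "m = (LEAST k. 1 \<le> k \<and> g k \<ge> 0)"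
  have m: "1 \<le> m" "g m \<ge> 0"
    using LeastI[of "\<lambda>k. 1 \<le> k \<and> g k \<ge> 0" n] assms(1) \<open>g n \<ge> 0\<close> by (auto simp: m_def)
  have "m \<le> n" unfolding m_def using assms(1) \<open>g n \<ge> 0\<close> by (intro Least_le) auto
  have "0 < w m * (\<Sum>k=1..n. g k)" using w_pos[of m] m \<open>m \<le> n\<close> sum_pos by simp
  also have "\<dots> \<le> (\<Sum>k=1..n. w k * g k)"
    unfolding sum_distrib_left
  proof (rule sum_mono)
    fix k assume k: "k \<in> {1..n}"
    show "w m * g k \<le> w k * g k"
    proof (cases "m \<le> k")
      case True
      then show ?thesis using k m w_mono[of m k] crossing[of m k] by (intro mult_right_mono) auto
    next
      case False
      then have "g k < 0" using not_less_Least[of k "\<lambda>k. 1 \<le> k \<and> g k \<ge> 0"] k by (auto simp: m_def)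
      then show ?thesis using False k w_mono[of k m] \<open>m \<le> n\<close> by (intro mult_right_mono_neg) auto
    qed
  qed
  finally show ?thesis .
qed

lemma power_sum_powr_minus:
  assumes "k \<ge> 1" "t > 0"
  shows "power_sum t k powr (- p) = t powr p * riemann_sum t k powr (- p) * real k powr (- (t * p))"
  using assms riemann_sum_pos[OF assms]
  by (simp add: power_sum_eq_riemann_sum powr_mult powr_divide powr_powr powr_minus field_simps)

text \<open>By \<open>power_sum_powr_minus\<close> both sides are sums of pure powers corrected by
  \<open>riemann_sum t k powr (- p)\<close>. The correction for \<open>r\<close> is at most the one
  for \<open>s\<close>, which is \<open>w\<close>. What remains is positivity of the sum of
  \<open>w k * g k\<close>, where \<open>w\<close> is nondecreasing and \<open>g\<close> has a
  single sign change.\<close>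

lemma inverse_sum_less:
  assumes "0 < p" "1 \<le> s" "s < r" "r * p < 1" "n \<ge> 1"
  shows "real n powr ((r - s) * p) * inverse_sum p r n < copson_const p r s * inverse_sum p s n"
proof -
  define w where "w k = riemann_sum s k powr (- p)" for k
  define c where "c = real n powr ((r - s) * p)"
  define g where "g k = (1 - s * p) * real k powr (- (s * p))
    - (1 - r * p) * c * real k powr (- (r * p))" for k
  have sp_rp: "s * p < r * p" using assms by simp
  have c_pos: "c > 0" using assms by (simp add: c_def)
  \<comment> \<open>The bracket is nondecreasing in \<open>k\<close>, so \<open>g\<close> can only
    pass from negative to nonnegative.\<close>
  have g_eq: "g k = real k powr (- (s * p)) *
      ((1 - s * p) - (1 - r * p) * (c * real k powr (- ((r - s) * p))))" if "k \<ge> 1" for k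
  proof -
    have "real k powr (- (r * p)) = real k powr (- (s * p)) * real k powr (- ((r - s) * p))"
      by (simp add: powr_add[symmetric] algebra_simps)
    then show ?thesis by (simp add: g_def algebra_simps)
  qed
  have "(\<Sum>k=1..n. w k * g k) > 0"
  proof (rule sum_mult_pos_of_single_crossing)
    show "w k > 0" if "1 \<le> k" "k \<le> n" for k
      using riemann_sum_pos[of k s] that assms by (simp add: w_def)
    show "w i \<le> w j" if "1 \<le> i" "i \<le> j" "j \<le> n" for i j
      unfolding w_def using that assms riemann_sum_decreasing[of s i j] riemann_sum_pos[of j s]
      by (intro powr_mono2') auto
    show "g j \<ge> 0" if ij: "1 \<le> i" "i \<le> j" "j \<le> n" and gi: "g i \<ge> 0" for i j
    proof -
      have "real j powr (- ((r - s) * p)) \<le> real i powr (- ((r - s) * p))"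
        using ij assms by (intro powr_mono2') auto
      then have "(1 - r * p) * (c * real j powr (- ((r - s) * p)))
          \<le> (1 - r * p) * (c * real i powr (- ((r - s) * p)))"
        using assms c_pos by (intro mult_left_mono) auto
      moreover have "(1 - s * p) - (1 - r * p) * (c * real i powr (- ((r - s) * p))) \<ge> 0"
        using gi ij by (simp add: g_eq zero_le_mult_iff)
      ultimately show ?thesis using ij by (simp add: g_eq)
    qed
    \<comment> \<open>So at \<open>k = n\<close> the bracket of \<open>g_eq\<close> equals
      \<open>(r - s) * p\<close>.\<close>
    have "c * real n powr (- ((r - s) * p)) = 1"
      using assms by (simp add: c_def powr_minus)
    then show "g n \<ge> 0" using assms sp_rp by (simp add: g_eq)
    \<comment> \<open>The sum of \<open>g\<close> is \<open>n powr (1 - s * p)\<close> times the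
      difference of these two Riemann sums.\<close>
    have "riemann_sum (1 - r * p) n < riemann_sum (1 - s * p) n"
      using assms sp_rp by (intro riemann_sum_strict_mono) auto
    then have "riemann_sum (1 - r * p) n * real n powr (1 - s * p)
        < riemann_sum (1 - s * p) n * real n powr (1 - s * p)"
      using assms by (intro mult_strict_right_mono) auto
    moreover have "real n powr (1 - s * p) = c * real n powr (1 - r * p)"
      by (simp add: c_def powr_add[symmetric] algebra_simps)
    then have "riemann_sum (1 - r * p) n * real n powr (1 - s * p)
        = (1 - r * p) * c * power_sum (1 - r * p) n"
      using assms by (simp add: riemann_sum_def)
    ultimately show "(\<Sum>k=1..n. g k) > 0"
      using assms
      by (simp add: riemann_sum_def power_sum_def g_def sum_subtractf sum_distrib_left mult.assoc)
  qed (use assms in auto)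
  then have "(1 - r * p) * c * (\<Sum>k=1..n. w k * real k powr (- (r * p)))
      < (1 - s * p) * (\<Sum>k=1..n. w k * real k powr (- (s * p)))"
    by (simp add: g_def sum_subtractf sum_distrib_left right_diff_distrib mult.left_commute mult.assoc)
  then have less: "c * (\<Sum>k=1..n. w k * real k powr (- (r * p)))
      < (1 - s * p) / (1 - r * p) * (\<Sum>k=1..n. w k * real k powr (- (s * p)))"
    using assms by (simp add: field_simps)
  have "inverse_sum p r n \<le> r powr p * (\<Sum>k=1..n. w k * real k powr (- (r * p)))"
    unfolding inverse_sum_def sum_distrib_left
  proof (rule sum_mono)
    fix k assume k: "k \<in> {1..n}"
    have "riemann_sum r k powr (- p) \<le> w k"
      unfolding w_def using k assms riemann_sum_strict_mono[of k s r] riemann_sum_pos[of k s]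
      by (intro powr_mono2') auto
    then show "power_sum r k powr (- p) \<le> r powr p * (w k * real k powr (- (r * p)))"
      using k assms by (simp add: power_sum_powr_minus mult.assoc mult_left_mono mult_right_mono)
  qed
  then have "c * inverse_sum p r n \<le> r powr p * (c * (\<Sum>k=1..n. w k * real k powr (- (r * p))))"
    using mult_left_mono[of _ _ c] c_pos by (simp add: mult.left_commute)
  also have "\<dots> < r powr p * ((1 - s * p) / (1 - r * p) * (\<Sum>k=1..n. w k * real k powr (- (s * p))))"
    using less assms by (intro mult_strict_left_mono) auto
  also have "\<dots> = copson_const p r s * (\<Sum>k=1..n. s powr p * (w k * real k powr (- (s * p))))"
    using assms by (simp add: copson_const_def sum_distrib_left[symmetric])
  also have "(\<Sum>k=1..n. s powr p * (w k * real k powr (- (s * p)))) = inverse_sum p s n"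
    unfolding inverse_sum_def using assms
    by (intro sum.cong) (auto simp: power_sum_powr_minus w_def)
  finally show ?thesis by (simp add: c_def)
qed

section \<open>The inequality for finite sums\<close>

text \<open>Tails cut off at \<open>N\<close>: convergence for the exponent \<open>r\<close> is part
  of the claim, so the inequality is proved for finite sums first.\<close>

definition partial_tail :: "real \<Rightarrow> (nat \<Rightarrow> real) \<Rightarrow> nat \<Rightarrow> nat \<Rightarrow> real" where
  "partial_tail t a N n = (\<Sum>k=n..N. real k powr (t - 1) * a k)"

lemma partial_tail_Suc:
  "n \<le> N \<Longrightarrow> partial_tail t a N n = partial_tail t a N (Suc n) + real n powr (t - 1) * a n"
  unfolding partial_tail_def by (simp add: sum.atLeast_Suc_atMost)

lemma partial_tail_nonneg:
  assumes "\<forall>k\<ge>1. a k \<ge> 0" "n \<ge> 1"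
  shows "partial_tail t a N n \<ge> 0"
  unfolding partial_tail_def using assms by (intro sum_nonneg) auto

lemma sum_by_parts:
  fixes u v :: "nat \<Rightarrow> real"
  shows "(\<Sum>n=1..N. v n * u n) =
    (\<Sum>n=1..N. (\<Sum>k=1..n. v k) * (u n - u (Suc n))) + (\<Sum>k=1..N. v k) * u (Suc N)"
  by (induction N) (auto simp: algebra_simps)

lemma powr_increment_le:
  fixes p x y d :: real
  assumes "0 < p" "p \<le> 1" "0 \<le> x" "x \<le> y" "0 \<le> d"
  shows "(y + d) powr p - y powr p \<le> (x + d) powr p - x powr p"
\<comment> \<open>The open-interval criterion is used because \<open>x = 0\<close> is allowed, where
  \<open>x powr p\<close> need not be differentiable.\<close>
proof (rule DERIV_nonpos_imp_decreasing_open[where f = "\<lambda>x. (x + d) powr p - x powr p"])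
  fix z assume z: "x < z" "z < y"
  have "((\<lambda>x. (x + d) powr p - x powr p) has_real_derivative
      (p * (z + d) powr (p - 1) - p * z powr (p - 1))) (at z)"
    using z assms by (auto intro!: derivative_eq_intros)
  moreover have "(z + d) powr (p - 1) \<le> z powr (p - 1)"
    using z assms by (intro powr_mono2') auto
  ultimately show "\<exists>D. ((\<lambda>x. (x + d) powr p - x powr p) has_real_derivative D) (at z) \<and> D \<le> 0"
    using assms by (auto intro!: mult_left_mono)
next
  show "continuous_on {x..y} (\<lambda>x. (x + d) powr p - x powr p)"
    using assms by (intro continuous_intros continuous_on_powr') auto
qed (use assms in auto)

text \<open>By concavity, replacing the tail of exponent \<open>r\<close> beyond \<open>n\<close> by the smaller quantity
  \<open>n powr (r - s)\<close> times the tail of exponent \<open>s\<close> can only enlarge the increment.\<close>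

lemma partial_tail_powr_increment_le:
  assumes "0 < p" "p \<le> 1" "s \<le> r" "\<forall>k\<ge>1. a k \<ge> 0" "1 \<le> n" "n \<le> N"
  shows "partial_tail r a N n powr p - partial_tail r a N (Suc n) powr p
    \<le> real n powr ((r - s) * p) *
      (partial_tail s a N n powr p - partial_tail s a N (Suc n) powr p)"
proof -
  define c where "c = real n powr (r - s)"
  define H where "H = partial_tail r a N (Suc n)"
  define T where "T = partial_tail s a N (Suc n)"
  define d where "d = real n powr (s - 1) * a n"
  have c: "c > 0" "c powr p = real n powr ((r - s) * p)" using assms by (auto simp: c_def powr_powr)
  have T: "T \<ge> 0" unfolding T_def using assms by (intro partial_tail_nonneg) auto
  have d: "d \<ge> 0" using assms by (simp add: d_def)
  have powr_eq: "real k powr (r - 1) = real k powr (r - s) * real k powr (s - 1)" for k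
    by (simp add: powr_add[symmetric])
  have "c * T \<le> H"
    unfolding H_def T_def partial_tail_def sum_distrib_left
  proof (rule sum_mono)
    fix k assume k: "k \<in> {Suc n..N}"
    have "c \<le> real k powr (r - s)" unfolding c_def using k assms by (intro powr_mono2) auto
    then show "c * (real k powr (s - 1) * a k) \<le> real k powr (r - 1) * a k"
      unfolding powr_eq mult.assoc using assms(4) k by (intro mult_right_mono) auto
  qed
  then have "(H + c * d) powr p - H powr p \<le> (c * T + c * d) powr p - (c * T) powr p"
    using assms c T d by (intro powr_increment_le) auto
  also have "\<dots> = c powr p * ((T + d) powr p - T powr p)"
    using c T d by (simp add: powr_mult distrib_left[symmetric] right_diff_distrib[symmetric])
  also have "H + c * d = partial_tail r a N n"
    using assms powr_eq[of n] by (simp add: partial_tail_Suc H_def c_def d_def)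
  also have "T + d = partial_tail s a N n"
    using assms by (simp add: partial_tail_Suc T_def d_def)
  finally show ?thesis by (simp add: c H_def T_def)
qed

text \<open>The slack in \<open>inverse_sum_less\<close>. It does not depend on the cutoff
  \<open>N\<close>, so it can keep the inequality strict in the limit.\<close>

definition weight_gap :: "real \<Rightarrow> real \<Rightarrow> real \<Rightarrow> nat \<Rightarrow> real" where
  "weight_gap p r s n =
    copson_const p r s * inverse_sum p s n - real n powr ((r - s) * p) * inverse_sum p r n"

text \<open>The boundary term of \<open>sum_by_parts\<close> vanishes: the tail from
  \<open>Suc N\<close> is an empty sum and \<open>0 powr p = 0\<close>.\<close>

lemma sum_partial_tail_by_parts:
  "(\<Sum>n=1..N. power_sum t n powr (- p) * partial_tail t a N n powr p) =
   (\<Sum>n=1..N. inverse_sum p t n * (partial_tail t a N n powr p - partial_tail t a N (Suc n) powr p))"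
  by (subst sum_by_parts) (simp add: inverse_sum_def partial_tail_def)

text \<open>Every index contributes a nonnegative slack; all are dropped except the one at
  \<open>m\<close>, later taken where \<open>a m > 0\<close>.\<close>

lemma sum_partial_tail_le:
  assumes "0 < p" "p < 1" "1 \<le> s" "s < r" "r * p < 1" "\<forall>k\<ge>1. a k \<ge> 0" "1 \<le> m" "m \<le> N"
  shows "(\<Sum>n=1..N. power_sum r n powr (- p) * partial_tail r a N n powr p)
    \<le> copson_const p r s * (\<Sum>n=1..N. power_sum s n powr (- p) * partial_tail s a N n powr p)
      - weight_gap p r s m * (partial_tail s a N m powr p - partial_tail s a N (Suc m) powr p)"
proof -
  define D where "D t n = partial_tail t a N n powr p - partial_tail t a N (Suc n) powr p" for t n
  have D_nonneg: "D s n \<ge> 0" if "n \<in> {1..N}" for n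
    unfolding D_def using that assms partial_tail_nonneg[of a "Suc n" s N]
    by (auto intro!: powr_mono2 simp: partial_tail_Suc)
  have "(\<Sum>n=1..N. inverse_sum p r n * D r n)
      \<le> (\<Sum>n=1..N. inverse_sum p r n * (real n powr ((r - s) * p) * D s n))"
    unfolding D_def using assms inverse_sum_pos[of _ p r]
    by (intro sum_mono mult_left_mono partial_tail_powr_increment_le) (auto intro: less_imp_le)
  also have "\<dots> = copson_const p r s * (\<Sum>n=1..N. inverse_sum p s n * D s n)
      - (\<Sum>n=1..N. weight_gap p r s n * D s n)"
    by (simp add: weight_gap_def sum_distrib_left sum_subtractf[symmetric] algebra_simps)
  finally have "(\<Sum>n=1..N. inverse_sum p r n * D r n)
      \<le> copson_const p r s * (\<Sum>n=1..N. inverse_sum p s n * D s n)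
        - (\<Sum>n=1..N. weight_gap p r s n * D s n)" .
  moreover have "weight_gap p r s m * D s m \<le> (\<Sum>n=1..N. weight_gap p r s n * D s n)"
    using assms D_nonneg inverse_sum_less[of p s r]
    by (intro member_le_sum) (auto simp: weight_gap_def less_imp_le)
  ultimately show ?thesis
    unfolding sum_partial_tail_by_parts D_def by linarith
qed

section \<open>Passage to infinite sums\<close>

text \<open>The intervals \<open>{m..N}\<close> eventually contain each finite subset of
  \<open>{m..}\<close>.\<close>

lemma sum_tendsto_infsum:
  fixes f :: "nat \<Rightarrow> real"
  assumes "f summable_on {m..}"
  shows "(\<lambda>N. \<Sum>k=m..N. f k) \<longlonglongrightarrow> (\<Sum>\<^sub>\<infinity>k\<in>{m..}. f k)"
proof -
  have "filterlim (\<lambda>N. {m..N}) (finite_subsets_at_top {m..}) sequentially"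
    unfolding filterlim_finite_subsets_at_top
  proof (intro allI impI)
    fix X :: "nat set" assume X: "finite X \<and> X \<subseteq> {m..}"
    then obtain n where "X \<subseteq> {..n}" by (auto simp: finite_nat_set_iff_bounded_le)
    then show "\<forall>\<^sub>F N in sequentially. finite {m..N} \<and> X \<subseteq> {m..N} \<and> {m..N} \<subseteq> {m..}"
      using X by (intro eventually_mono[OF eventually_ge_at_top[of n]]) force
  qed
  then show ?thesis
    using has_sum_infsum[OF assms] unfolding has_sum_def by (rule filterlim_compose[rotated])
qed

lemma
  fixes f :: "nat \<Rightarrow> real"
  assumes nonneg: "\<And>k. k \<ge> m \<Longrightarrow> f k \<ge> 0" and bound: "\<And>N. (\<Sum>k=m..N. f k) \<le> B"
  shows summable_on_of_bounded_sums: "f summable_on {m..}"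
    and infsum_le_of_bounded_sums: "(\<Sum>\<^sub>\<infinity>k\<in>{m..}. f k) \<le> B"
proof -
  have bounded: "sum f F \<le> B" if F: "finite F" "F \<subseteq> {m..}" for F
  proof -
    obtain N where "F \<subseteq> {..N}" using F(1) by (auto simp: finite_nat_set_iff_bounded_le)
    then have "sum f F \<le> (\<Sum>k=m..N. f k)" using F nonneg by (intro sum_mono2) auto
    with bound[of N] show ?thesis by simp
  qed
  show "f summable_on {m..}"
    by (rule nonneg_bounded_partial_sums_imp_summable_on[where C = B])
      (use nonneg bounded in \<open>auto intro!: eventually_finite_subsets_at_top_weakI\<close>)
  then show "(\<Sum>\<^sub>\<infinity>k\<in>{m..}. f k) \<le> B"
    by (rule infsum_le_finite_sums) (rule bounded)
qed

definition tail :: "real \<Rightarrow> (nat \<Rightarrow> real) \<Rightarrow> nat \<Rightarrow> real" where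
  "tail t a n = (\<Sum>\<^sub>\<infinity>k\<in>{n..}. real k powr (t - 1) * a k)"

lemma tail_nonneg:
  assumes "\<forall>k\<ge>1. a k \<ge> 0" "n \<ge> 1"
  shows "tail t a n \<ge> 0"
  unfolding tail_def using assms by (intro infsum_nonneg) auto

lemma tail_mean_powr:
  assumes "\<forall>k\<ge>1. a k \<ge> 0" "n \<ge> 1"
  shows "tail_mean t a n powr p = power_sum t n powr (- p) * tail t a n powr p"
proof -
  have eq: "tail_mean t a n = tail t a n / power_sum t n"
    by (simp add: tail_mean_def tail_def power_sum_def)
  show ?thesis
    unfolding eq using tail_nonneg[OF assms] power_sum_pos[OF assms(2), of t]
    by (simp add: powr_divide powr_minus field_simps)
qed

lemma partial_tail_tendsto:
  assumes "(\<lambda>k. real k powr (t - 1) * a k) summable_on {n..}"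
  shows "(\<lambda>N. partial_tail t a N n) \<longlonglongrightarrow> tail t a n"
  unfolding partial_tail_def tail_def by (rule sum_tendsto_infsum[OF assms])

lemma partial_tail_le_tail:
  assumes "\<forall>k\<ge>1. a k \<ge> 0" "n \<ge> 1" "(\<lambda>k. real k powr (t - 1) * a k) summable_on {n..}"
  shows "partial_tail t a N n \<le> tail t a n"
  unfolding partial_tail_def tail_def using assms by (intro finite_sum_le_infsum) auto

text \<open>The finite inequality is passed to the limit with its slack at \<open>m\<close>, which
  tends to \<open>\<epsilon> * \<delta>' > 0\<close>. Summability for \<open>r\<close> is extracted
  from the same bound.\<close>

lemma tail_mean_sum_less:
  assumes prs: "0 < p" "p < 1" "1 \<le> s" "s < r" "r * p < 1" and adm: "admissible p s a"
  shows "tail_mean_finite p r a" "tail_mean_sum p r a < copson_const p r s * tail_mean_sum p s a"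
proof -
  have a: "\<forall>k\<ge>1. a k \<ge> 0"
    using adm by (simp add: admissible_def)
  have summable_s: "(\<lambda>k. real k powr (s - 1) * a k) summable_on {n..}" if "n \<ge> 1" for n
    using adm that by (simp add: admissible_def tail_mean_finite_def)
  obtain m where m: "m \<ge> 1" "a m > 0"
    using adm a by (auto simp: admissible_def less_le)
  define C where "C = copson_const p r s"
  define \<alpha> where "\<alpha> = tail_mean_sum p s a"
  define \<delta> where "\<delta> N = partial_tail s a N m powr p - partial_tail s a N (Suc m) powr p" for N
  define \<delta>' where "\<delta>' = tail s a m powr p - tail s a (Suc m) powr p"
  define \<epsilon> where "\<epsilon> = weight_gap p r s m"
  have "s * p < r * p" using prs by simp
  then have "s * p < 1" using prs by linarith
  then have "C > 0" using prs unfolding C_def copson_const_def by simp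
  have "\<epsilon> > 0" using inverse_sum_less[OF prs(1,3-5) m(1)] by (simp add: \<epsilon>_def weight_gap_def)

  have sum_s: "(\<Sum>n=1..N. power_sum s n powr (- p) * partial_tail s a N n powr p) \<le> \<alpha>" for N
  proof -
    have "(\<Sum>n=1..N. power_sum s n powr (- p) * partial_tail s a N n powr p)
        \<le> (\<Sum>n=1..N. tail_mean s a n powr p)"
    proof (rule sum_mono)
      fix n assume "n \<in> {1..N}"
      then have n: "n \<ge> 1" by simp
      show "power_sum s n powr (- p) * partial_tail s a N n powr p \<le> tail_mean s a n powr p"
        unfolding tail_mean_powr[OF a n]
        using partial_tail_le_tail[OF a n summable_s[OF n]] partial_tail_nonneg[OF a n] prs
        by (intro mult_left_mono powr_mono2) auto
    qed
    also have "\<dots> \<le> \<alpha>"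
      unfolding \<alpha>_def tail_mean_sum_def using adm
      by (intro finite_sum_le_infsum) (auto simp: admissible_def tail_mean_finite_def)
    finally show ?thesis .
  qed
  \<comment> \<open>Two cutoffs: \<open>M\<close> for the outer sum stays fixed while
    \<open>N\<close> for the inner tails tends to infinity.\<close>
  have bound: "(\<Sum>n=1..M. power_sum r n powr (- p) * partial_tail r a N n powr p) \<le> C * \<alpha> - \<epsilon> * \<delta> N"
    if "M \<le> N" "m \<le> N" for M N
  proof -
    have "(\<Sum>n=1..M. power_sum r n powr (- p) * partial_tail r a N n powr p)
        \<le> (\<Sum>n=1..N. power_sum r n powr (- p) * partial_tail r a N n powr p)"
      using that by (intro sum_mono2) auto
    also have "\<dots> \<le> C * (\<Sum>n=1..N. power_sum s n powr (- p) * partial_tail s a N n powr p) - \<epsilon> * \<delta> N"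
      unfolding C_def \<epsilon>_def \<delta>_def using that m a prs by (intro sum_partial_tail_le) auto
    also have "\<dots> \<le> C * \<alpha> - \<epsilon> * \<delta> N"
      using sum_s[of N] \<open>C > 0\<close> by (simp add: mult_left_mono)
    finally show ?thesis .
  qed

  \<comment> \<open>Since \<open>power_sum r 1 = 1\<close>, the term \<open>n = 1\<close> alone
    bounds the truncated series uniformly in \<open>N\<close>.\<close>
  have "partial_tail r a N 1 \<le> (C * \<alpha>) powr (1 / p)" for N
  proof -
    \<comment> \<open>\<open>bound\<close> needs a cutoff of at least \<open>m\<close>; enlarging it
      only increases the tail.\<close>
    define N' where "N' = max N m"
    have "\<delta> N' \<ge> 0"
      unfolding \<delta>_def N'_def using m prs partial_tail_nonneg[of a "Suc m" s, OF a]
      by (auto intro!: powr_mono2 simp: partial_tail_Suc)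
    then have "\<epsilon> * \<delta> N' \<ge> 0" using \<open>\<epsilon> > 0\<close> by simp
    moreover have "1 \<le> N'" "m \<le> N'" using m by (auto simp: N'_def)
    ultimately have "(\<Sum>n=1..1. power_sum r n powr (- p) * partial_tail r a N' n powr p) \<le> C * \<alpha>"
      using bound[of 1 N'] by linarith
    then have "partial_tail r a N' 1 powr p \<le> C * \<alpha>"
      by (simp add: power_sum_def)
    then have "(partial_tail r a N' 1 powr p) powr (1 / p) \<le> (C * \<alpha>) powr (1 / p)"
      using prs by (intro powr_mono2) auto
    then have "partial_tail r a N' 1 \<le> (C * \<alpha>) powr (1 / p)"
      using prs partial_tail_nonneg[of a 1 r N', OF a] by (simp add: powr_powr)
    moreover have "partial_tail r a N 1 \<le> partial_tail r a N' 1"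
      unfolding partial_tail_def N'_def using a by (intro sum_mono2) auto
    ultimately show ?thesis by simp
  qed
  then have "(\<lambda>k. real k powr (r - 1) * a k) summable_on {1..}"
    by (intro summable_on_of_bounded_sums) (auto simp: partial_tail_def a)
  then have summable_r: "(\<lambda>k. real k powr (r - 1) * a k) summable_on {n..}" if "n \<ge> 1" for n
    by (rule summable_on_subset) (use that in auto)

  have "\<delta> \<longlonglongrightarrow> \<delta>'"
    unfolding \<delta>_def \<delta>'_def using m a prs partial_tail_nonneg[OF a]
    by (intro tendsto_diff tendsto_powr' partial_tail_tendsto summable_s tendsto_const) auto
  have sum_r: "(\<Sum>n=1..M. tail_mean r a n powr p) \<le> C * \<alpha> - \<epsilon> * \<delta>'" for M
  proof (rule LIMSEQ_le)
    show "(\<lambda>N. \<Sum>n=1..M. power_sum r n powr (- p) * partial_tail r a N n powr p)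
        \<longlonglongrightarrow> (\<Sum>n=1..M. tail_mean r a n powr p)"
    proof (rule tendsto_sum)
      fix n assume "n \<in> {1..M}"
      then have n: "n \<ge> 1" by simp
      show "(\<lambda>N. power_sum r n powr (- p) * partial_tail r a N n powr p)
          \<longlonglongrightarrow> tail_mean r a n powr p"
        unfolding tail_mean_powr[OF a n]
        using n prs partial_tail_nonneg[OF a n]
        by (intro tendsto_mult tendsto_powr' partial_tail_tendsto summable_r tendsto_const) auto
    qed
    show "(\<lambda>N. C * \<alpha> - \<epsilon> * \<delta> N) \<longlonglongrightarrow> C * \<alpha> - \<epsilon> * \<delta>'"
      by (intro tendsto_intros \<open>\<delta> \<longlonglongrightarrow> \<delta>'\<close>)
    show "\<exists>K. \<forall>N\<ge>K. (\<Sum>n=1..M. power_sum r n powr (- p) * partial_tail r a N n powr p)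
        \<le> C * \<alpha> - \<epsilon> * \<delta> N"
      using bound by (intro exI[of _ "max M m"]) auto
  qed
  show "tail_mean_finite p r a"
    unfolding tail_mean_finite_def
    using summable_r summable_on_of_bounded_sums[OF _ sum_r] by auto
  \<comment> \<open>The positive entry at \<open>m\<close> makes the tail drop there, hence
    \<open>\<delta>' > 0\<close>.\<close>
  have "tail s a (Suc m) < tail s a m"
  proof -
    have "{m..} = insert m {Suc m..}" by auto
    then have "tail s a m = real m powr (s - 1) * a m + tail s a (Suc m)"
      unfolding tail_def using summable_s[of "Suc m"] by (simp add: infsum_insert)
    moreover have "real m powr (s - 1) * a m > 0" using m by simp
    ultimately show ?thesis by simp
  qed
  then have "\<delta>' > 0"
    using prs tail_nonneg[of a "Suc m" s, OF a] by (simp add: \<delta>'_def powr_less_mono2)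
  have "tail_mean_sum p r a \<le> C * \<alpha> - \<epsilon> * \<delta>'"
    unfolding tail_mean_sum_def by (rule infsum_le_of_bounded_sums[OF _ sum_r]) simp
  also have "\<dots> < C * \<alpha>" using \<open>\<epsilon> > 0\<close> \<open>\<delta>' > 0\<close> by simp
  finally show "tail_mean_sum p r a < copson_const p r s * tail_mean_sum p s a"
    by (simp add: C_def \<alpha>_def)
qed

section \<open>Sharpness\<close>

text \<open>Riemann sums with exponent 1 equal 1, so monotonicity in the exponent gives at least 1
  for \<open>s\<close> and at most 1 for \<open>1 - s * p\<close>.\<close>

lemma inverse_sum_le:
  assumes "0 < p" "1 \<le> s" "s * p < 1" "n \<ge> 1"
  shows "inverse_sum p s n \<le> s powr p * real n powr (1 - s * p) / (1 - s * p)"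
proof -
  have riemann_1: "riemann_sum 1 k = 1" if "k \<ge> 1" for k
    using that by (simp add: riemann_sum_def power_sum_def)
  have "inverse_sum p s n \<le> (\<Sum>k=1..n. s powr p * real k powr (- (s * p)))"
    unfolding inverse_sum_def
  proof (rule sum_mono)
    fix k assume k: "k \<in> {1..n}"
    have "riemann_sum s k \<ge> 1"
      using riemann_sum_strict_mono[of k 1 s] riemann_1[of k] k assms by (cases "s = 1") auto
    then have "riemann_sum s k powr (- p) \<le> 1 powr (- p)"
      using assms by (intro powr_mono2') auto
    then have "s powr p * riemann_sum s k powr (- p) * real k powr (- (s * p))
        \<le> s powr p * 1 * real k powr (- (s * p))"
      by (intro mult_right_mono mult_left_mono) auto
    then show "power_sum s k powr (- p) \<le> s powr p * real k powr (- (s * p))"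
      using k assms by (simp add: power_sum_powr_minus)
  qed
  also have "\<dots> = s powr p * power_sum (1 - s * p) n"
    by (simp add: power_sum_def sum_distrib_left)
  also have "\<dots> = s powr p * (riemann_sum (1 - s * p) n * real n powr (1 - s * p) / (1 - s * p))"
    using assms power_sum_eq_riemann_sum[of n "1 - s * p"] by simp
  also have "\<dots> \<le> s powr p * (1 * real n powr (1 - s * p) / (1 - s * p))"
    using assms riemann_sum_strict_mono[of n "1 - s * p" 1] riemann_1[of n]
    by (intro mult_left_mono mult_right_mono divide_right_mono) auto
  finally show ?thesis by simp
qed

text \<open>An integral-type bound valid for all \<open>t > 0\<close>, obtained from
  \<open>power_sum_ln_le\<close> and \<open>ln ((n + 1) / n) \<ge> 1 / (n + 1)\<close>.\<close>

lemma power_sum_le: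
  assumes "n \<ge> 1" "t > 0"
  shows "power_sum t n \<le> (real n + 1) powr t / t"
proof -
  have "ln (real n / (real n + 1)) \<le> real n / (real n + 1) - 1"
    using assms by (intro ln_le_minus_one) auto
  also have "\<dots> = - (1 / (real n + 1))" using assms by (simp add: field_simps)
  finally have "1 / (real n + 1) \<le> ln ((real n + 1) / real n)"
    using assms by (simp add: ln_div)
  then have "t * power_sum t n * (1 / (real n + 1)) \<le> t * power_sum t n * ln ((real n + 1) / real n)"
    using assms power_sum_nonneg[of t n] by (intro mult_left_mono) auto
  also have "\<dots> \<le> (real n + 1) powr (t - 1)" by (rule power_sum_ln_le[OF assms])
  also have "\<dots> = (real n + 1) powr t * (1 / (real n + 1))" by (simp add: powr_diff)
  finally have "t * power_sum t n \<le> (real n + 1) powr t"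
    by (rule mult_right_le_imp_le) simp
  then show ?thesis using assms by (simp add: field_simps)
qed

lemma powr_succ_diff_le:
  fixes x t :: real
  assumes "0 < x" "0 < t" "t \<le> 1"
  shows "((x + 1) powr t - x powr t) / t \<le> x powr (t - 1)"
proof -
  have "\<exists>z. x < z \<and> z < x + 1 \<and>
      (x + 1) powr t - x powr t = (x + 1 - x) * (t * z powr (t - 1))"
    using assms by (intro MVT2) (auto intro!: derivative_eq_intros)
  then obtain z where z: "x < z" "(x + 1) powr t - x powr t = t * z powr (t - 1)" by auto
  have "z powr (t - 1) \<le> x powr (t - 1)" using z assms by (intro powr_mono2') auto
  then show ?thesis using z assms by simp
qed

text \<open>Matches the growth in \<open>inverse_sum_le\<close> up to a constant:
  \<open>power_sum_le\<close> bounds each summand and the resulting powers are compared with a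
  telescoping sum. The 2 absorbs its initial term \<open>2 powr t\<close>.\<close>

lemma inverse_sum_ge:
  assumes "0 < p" "0 < r" "r * p < 1"
  shows "inverse_sum p r n \<ge> r powr p * (real n powr (1 - r * p) - 2) / (1 - r * p)"
proof -
  define t where "t = 1 - r * p"
  have t: "0 < t" "t \<le> 1" using assms by (auto simp: t_def)
  have "((real n + 2) powr t - 2 powr t) / t \<le> (\<Sum>k=1..n. (real k + 1) powr (t - 1))"
  proof (induction n)
    case (Suc n)
    then show ?case using powr_succ_diff_le[of "real n + 2" t] t
      by (simp add: diff_divide_distrib add.commute)
  qed simp
  moreover have "real n powr t \<le> (real n + 2) powr t" using t by (intro powr_mono2) auto
  moreover have "(2::real) powr t \<le> 2" using t powr_mono[of t 1 "2::real"] by simp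
  ultimately have "(real n powr t - 2) / t \<le> (\<Sum>k=1..n. (real k + 1) powr (t - 1))"
    using t by (smt (verit) divide_right_mono)
  then have "r powr p * ((real n powr t - 2) / t) \<le> r powr p * (\<Sum>k=1..n. (real k + 1) powr (t - 1))"
    by (rule mult_left_mono) simp
  also have "\<dots> \<le> inverse_sum p r n"
    unfolding inverse_sum_def sum_distrib_left
  proof (rule sum_mono)
    fix k assume k: "k \<in> {1..n}"
    have "((real k + 1) powr r / r) powr (- p) \<le> power_sum r k powr (- p)"
      using k assms power_sum_le[of k r] power_sum_pos[of k r] by (intro powr_mono2') auto
    then show "r powr p * (real k + 1) powr (t - 1) \<le> power_sum r k powr (- p)"
      using assms by (simp add: t_def powr_divide powr_powr powr_minus field_simps)
  qed
  finally show ?thesis by (simp add: t_def)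
qed

text \<open>For \<open>n \<le> N\<close> every tail is the same single term, so the double series
  has a closed form. Working with \<open>has_sum\<close> yields convergence and value
  together.\<close>

lemma
  assumes "N \<ge> 1"
  defines "a \<equiv> \<lambda>k::nat. if k = N then 1 else 0 :: real"
  shows tail_mean_finite_unit: "tail_mean_finite p t a"
    and tail_mean_sum_unit: "tail_mean_sum p t a = real N powr ((t - 1) * p) * inverse_sum p t N"
proof -
  have term_has_sum: "((\<lambda>k. real k powr (t - 1) * a k) has_sum
      (if n \<le> N then real N powr (t - 1) else 0)) {n..}" for n
    by (rule has_sum_finite_neutralI[of "{N} \<inter> {n..}"]) (auto simp: a_def)
  then have "tail t a n = (if n \<le> N then real N powr (t - 1) else 0)" for n
    unfolding tail_def by (rule infsumI)
  moreover have "\<forall>k\<ge>1. a k \<ge> 0" by (simp add: a_def)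
  ultimately have mean: "tail_mean t a n powr p =
      (if n \<le> N then real N powr ((t - 1) * p) * power_sum t n powr (- p) else 0)" if "n \<ge> 1" for n
    using that by (simp add: tail_mean_powr powr_powr)
  have "((\<lambda>n. tail_mean t a n powr p) has_sum (real N powr ((t - 1) * p) * inverse_sum p t N)) {1..}"
    by (rule has_sum_finite_neutralI[of "{1..N}"])
      (auto simp: mean inverse_sum_def sum_distrib_left intro!: sum.cong)
  then show "tail_mean_finite p t a"
    and "tail_mean_sum p t a = real N powr ((t - 1) * p) * inverse_sum p t N"
    using term_has_sum
    by (auto simp: tail_mean_finite_def tail_mean_sum_def infsumI intro: has_sum_imp_summable)
qed

text \<open>For a single entry at \<open>N\<close> both sums are of order
  \<open>N powr (1 - p)\<close>, and their quotient tends to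
  \<open>copson_const p r s\<close>.\<close>

lemma tail_mean_sum_sharp:
  assumes prs: "0 < p" "1 \<le> s" "s < r" "r * p < 1" and c: "c < copson_const p r s"
  shows "\<exists>a. admissible p s a \<and> tail_mean_finite p r a \<and>
    tail_mean_sum p r a > c * tail_mean_sum p s a"
proof -
  have "s * p < r * p" using prs by simp
  then have sp: "s * p < 1" using prs by linarith
  \<comment> \<open>The leading coefficient of \<open>inverse_sum p t N\<close> as a multiple of
    \<open>N powr (1 - t * p)\<close>.\<close>
  define K where "K t = t powr p / (1 - t * p)" for t
  have K_pos: "K s > 0" "K r > 0" using prs sp by (auto simp: K_def)
  \<comment> \<open>\<open>c\<close> may be negative; the upper bound for the sum with
    \<open>s\<close> can only be multiplied by a nonnegative constant.\<close>
  define d where "d = max c 0"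
  have "copson_const p r s = K r / K s" by (simp add: copson_const_def K_def)
  then have "d < K r / K s" using c K_pos by (simp add: d_def)
  then have d: "d \<ge> 0" "c \<le> d" "d * K s < K r"
    using K_pos by (simp_all add: d_def pos_less_divide_eq)
  \<comment> \<open>The relative error caused by the 2 in \<open>inverse_sum_ge\<close> tends to
    0.\<close>
  have "(\<lambda>N. real N powr (- (1 - r * p))) \<longlonglongrightarrow> 0"
    using prs by (intro tendsto_neg_powr filterlim_real_sequentially) auto
  then have "(\<lambda>N. K r * (1 - 2 * real N powr (- (1 - r * p)))) \<longlonglongrightarrow> K r * (1 - 2 * 0)"
    by (intro tendsto_intros)
  then have "\<forall>\<^sub>F N in sequentially. d * K s < K r * (1 - 2 * real N powr (- (1 - r * p)))"
    using d(3) by (intro order_tendstoD(1)) auto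
  then have "\<forall>\<^sub>F N in sequentially. N \<ge> 1 \<and> d * K s < K r * (1 - 2 * real N powr (- (1 - r * p)))"
    using eventually_ge_at_top by (rule eventually_conj[rotated])
  then obtain N :: nat where N: "N \<ge> 1" "d * K s < K r * (1 - 2 * real N powr (- (1 - r * p)))"
    by (auto dest: eventually_happens)
  define a where "a = (\<lambda>k::nat. if k = N then 1 else 0 :: real)"
  \<comment> \<open>The exponents add up to \<open>1 - p\<close> for every \<open>t\<close>, so the
    powers of \<open>N\<close> on both sides agree.\<close>
  have powr_N: "real N powr ((t - 1) * p) * real N powr (1 - t * p) = real N powr (1 - p)" for t
    by (simp add: powr_add[symmetric] algebra_simps)
  have "tail_mean_sum p s a \<ge> 0"
    unfolding tail_mean_sum_def by (intro infsum_nonneg) auto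
  then have "c * tail_mean_sum p s a \<le> d * tail_mean_sum p s a"
    using d by (intro mult_right_mono)
  also have "\<dots> \<le> d * (real N powr ((s - 1) * p) * (K s * real N powr (1 - s * p)))"
    using d inverse_sum_le[OF prs(1,2) sp N(1)] unfolding a_def tail_mean_sum_unit[OF N(1)]
    by (intro mult_left_mono) (auto simp: K_def)
  also have "\<dots> = d * K s * real N powr (1 - p)"
    using powr_N[of s] by (simp add: mult.left_commute mult.assoc)
  also have "\<dots> < K r * (1 - 2 * real N powr (- (1 - r * p))) * real N powr (1 - p)"
    using N by (intro mult_strict_right_mono) auto
  also have "\<dots> = real N powr ((r - 1) * p) * (K r * (real N powr (1 - r * p) - 2))"
  proof -
    have "real N powr (1 - r * p) * (1 - 2 * real N powr (- (1 - r * p))) = real N powr (1 - r * p) - 2"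
    proof -
      have "real N powr (1 - r * p) * real N powr (- (1 - r * p)) = 1"
        using N(1) by (simp add: powr_add[symmetric])
      then show ?thesis by (simp add: right_diff_distrib mult.left_commute)
    qed
    then show ?thesis by (simp add: powr_N[of r, symmetric] mult.left_commute mult.assoc mult.commute)
  qed
  also have "\<dots> \<le> tail_mean_sum p r a"
    using inverse_sum_ge[of p r N] prs unfolding a_def tail_mean_sum_unit[OF N(1)]
    by (intro mult_left_mono) (auto simp: K_def)
  finally have "c * tail_mean_sum p s a < tail_mean_sum p r a" .
  moreover have "admissible p s a"
    unfolding admissible_def a_def using N(1) tail_mean_finite_unit[OF N(1)] by auto
  ultimately show ?thesis
    using tail_mean_finite_unit[OF N(1)] unfolding a_def by blast
qed

theorem theorem4p4:
  fixes p r s :: real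
  assumes "0 < p" "p < 1" "1 \<le> s" "s < r" "r < 1 / p"
  shows "(\<forall>a. admissible p s a \<longrightarrow>
            tail_mean_finite p r a \<and>
            tail_mean_sum p r a < copson_const p r s * tail_mean_sum p s a) \<and>
         (\<forall>c < copson_const p r s. \<exists>a. admissible p s a \<and> tail_mean_finite p r a \<and>
            tail_mean_sum p r a > c * tail_mean_sum p s a)"
proof -
  have "r * p < 1" using assms by (simp add: field_simps)
  with assms show ?thesis
    by (auto intro: tail_mean_sum_less tail_mean_sum_sharp)
qed

end
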